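(* Let $a\in\mathbb{R}$ be irrational. Then $\mathcal{R}_a=(\mathbb{R},<,+,\mathbb{Z},\mathbb{Z}a)$ defines an isomorphic copy of the two-sorted structure $\mathcal{B}=(\mathbb{N},\mathcal{P}(\mathbb{N}),s_{\mathbb{N}},\in)$; that is, there are sets $W,J\subseteq\mathbb{R}^{n}$ (for suitable $n$), a function $s:W\to W$ and a relation $E\subseteq W\times J$, all definable without parameters in $\mathcal{R}_a$, such that $(W,J,s,E)$ is isomorphic to $(\mathbb{N},\mathcal{P}(\mathbb{N}),s_{\mathbb{N}},\in)$.
   Context: $\mathcal{B}$ has sorts $\mathbb{N}=\{0,1,2,\dots\}$ and $\mathcal{P}(\mathbb{N})$, with $s_{\mathbb{N}}$ the successor function on $\mathbb{N}$ and $\in$ the membership relation between $\mathbb{N}$ and $\mathcal{P}(\mathbb{N})$. $\mathcal{R}_a$ is the expansion of $(\mathbb{R},<,+)$ by unary predicates for $\mathbb{Z}$ and $\mathbb{Z}a=\{za:z\in\mathbb{Z}\}$. *)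

theory Defs
  imports Complex_Main
begin

text \<open>
  First-order terms and formulas (with equality) in the language with a binary relation symbol
  for the order, a binary function symbol for addition, and two unary predicate symbols.
  Variables are named by natural numbers; there are no constant symbols, so a formula cannot
  refer to parameters.
\<close>

datatype trm = Var nat | Add trm trm

datatype fml =
    Eq trm trm
  | Less trm trm
  | InZ trm
  | InZa trm
  | Neg fml
  | And fml fml
  | Ex nat fml

fun trm_vars :: "trm \<Rightarrow> nat set" where
  "trm_vars (Var i) = {i}"
| "trm_vars (Add t u) = trm_vars t \<union> trm_vars u"

fun free_vars :: "fml \<Rightarrow> nat set" where
  "free_vars (Eq t u) = trm_vars t \<union> trm_vars u"
| "free_vars (Less t u) = trm_vars t \<union> trm_vars u"
| "free_vars (InZ t) = trm_vars t"
| "free_vars (InZa t) = trm_vars t"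
| "free_vars (Neg p) = free_vars p"
| "free_vars (And p q) = free_vars p \<union> free_vars q"
| "free_vars (Ex i p) = free_vars p - {i}"

fun trm_val :: "(nat \<Rightarrow> real) \<Rightarrow> trm \<Rightarrow> real" where
  "trm_val e (Var i) = e i"
| "trm_val e (Add t u) = trm_val e t + trm_val e u"

text \<open>\<open>sat a e p\<close>: the formula \<open>p\<close> holds in \<open>(\<real>, <, +, \<int>, \<int>a)\<close> under the assignment \<open>e\<close>.\<close>

fun sat :: "real \<Rightarrow> (nat \<Rightarrow> real) \<Rightarrow> fml \<Rightarrow> bool" where
  "sat a e (Eq t u) \<longleftrightarrow> trm_val e t = trm_val e u"
| "sat a e (Less t u) \<longleftrightarrow> trm_val e t < trm_val e u"
| "sat a e (InZ t) \<longleftrightarrow> trm_val e t \<in> \<int>"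
| "sat a e (InZa t) \<longleftrightarrow> trm_val e t \<in> {of_int z * a | z :: int. True}"
| "sat a e (Neg p) \<longleftrightarrow> \<not> sat a e p"
| "sat a e (And p q) \<longleftrightarrow> sat a e p \<and> sat a e q"
| "sat a e (Ex i p) \<longleftrightarrow> (\<exists>x. sat a (e(i := x)) p)"

text \<open>
  Points of \<open>\<real>\<^sup>n\<close> are lists of length \<open>n\<close>, since the dimension is quantified inside the
  statement; \<open>\<real>\<^sup>m \<times> \<real>\<^sup>n\<close> is identified with \<open>\<real>\<^sup>m\<^sup>+\<^sup>n\<close> by concatenation.
\<close>

definition real_space :: "nat \<Rightarrow> real list set" where
  "real_space n = {xs. length xs = n}"

text \<open>
  Definability without parameters in \<open>(\<real>, <, +, \<int>, \<int>a)\<close>. The value of \<open>xs ! i\<close> for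
  \<open>i \<ge> n\<close> is irrelevant, because the free variables are bounded by \<open>n\<close>.
\<close>

definition definable :: "real \<Rightarrow> nat \<Rightarrow> real list set \<Rightarrow> bool" where
  "definable a n X \<longleftrightarrow>
     (\<exists>p. free_vars p \<subseteq> {..<n} \<and> X = {xs \<in> real_space n. sat a (\<lambda>i. xs ! i) p})"

definition definable_fun ::
    "real \<Rightarrow> nat \<Rightarrow> real list set \<Rightarrow> (real list \<Rightarrow> real list) \<Rightarrow> bool" where
  "definable_fun a n W s \<longleftrightarrow> definable a (n + n) {w @ s w | w. w \<in> W}"

definition definable_rel :: "real \<Rightarrow> nat \<Rightarrow> (real list \<times> real list) set \<Rightarrow> bool" where
  "definable_rel a n E \<longleftrightarrow> definable a (n + n) {w @ j | w j. (w, j) \<in> E}"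

definition two_sorted_iso ::
    "'w set \<Rightarrow> 'j set \<Rightarrow> ('w \<Rightarrow> 'w) \<Rightarrow> ('w \<times> 'j) set \<Rightarrow>
     'v set \<Rightarrow> 'k set \<Rightarrow> ('v \<Rightarrow> 'v) \<Rightarrow> ('v \<times> 'k) set \<Rightarrow> bool" where
  "two_sorted_iso W J s E W' J' s' E' \<longleftrightarrow>
     (\<exists>f g. bij_betw f W W' \<and> bij_betw g J J' \<and>
        (\<forall>w\<in>W. f (s w) = s' (f w)) \<and>
        (\<forall>w\<in>W. \<forall>j\<in>J. (w, j) \<in> E \<longleftrightarrow> (f w, g j) \<in> E'))"

end

theory Submission
  imports Defs "HOL-Analysis.Kronecker_Approximation_Theorem"
begin

text \<open>
  Put \<open>b = \<bar>a\<bar>\<close> and represent \<open>N\<close> by those multiples \<open>P\<^sub>i b\<close> with \<open>P\<^sub>i > 1\<close> whose distance \<open>w\<^sub>i\<close> to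
  the nearest integer is smaller than that of every earlier positive multiple of \<open>b\<close>, and which lie
  above that integer. This set is definable, and so is its order. Best approximations alternate in
  sign and satisfy \<open>\<bar>\<beta>\<^sub>k\<bar> \<ge> \<bar>\<beta>\<^sub>k\<^sub>+\<^sub>1\<bar> + \<bar>\<beta>\<^sub>k\<^sub>+\<^sub>2\<bar>\<close>, so \<open>w\<^sub>i\<close> exceeds the sum of all later \<open>w\<^sub>j\<close>, and a
  set \<open>X\<close> is determined by the real number \<open>c = \<Sum>i\<in>X. w\<^sub>i\<close> (a sparse Ostrowski expansion).
  The partial sum over \<open>j < i\<close> can be recovered definably: it is the largest number \<open>t \<le> c\<close>
  congruent modulo the integers to some \<open>n b\<close> with \<open>0 \<le> n < P\<^sub>i\<close>. Hence \<open>i \<in> X\<close> means \<open>t + w\<^sub>i \<le> c\<close>, and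
  the codes are the reals whose successive truncations change by \<open>0\<close> or \<open>w\<^sub>i\<close> according to this rule.
\<close>

subsection \<open>Best approximations\<close>

locale irrational =
  fixes a :: real
  assumes irrational: "a \<notin> \<rat>"
begin

text \<open>With the absolute value, the nonnegative elements of \<open>Za\<close> are exactly the
  natural multiples of \<open>b\<close>, whatever the sign of \<open>a\<close>.\<close>

definition b :: real where "b = \<bar>a\<bar>"

text \<open>Irrationality makes \<open>n\<close> unique for given \<open>v\<close>, so
  \<open>n\<close> acts as an index of \<open>v\<close>. Only natural indices count; a negative
  multiple of \<open>b\<close> gives none.\<close>

definition represents :: "nat \<Rightarrow> real \<Rightarrow> bool" where
  "represents n v \<longleftrightarrow> real n * b - v \<in> \<int>"

definition residue :: "nat \<Rightarrow> real" where
  "residue n = real n * b - of_int (round (real n * b))"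

lemma b_irrational: "b \<notin> \<rat>"
  using irrational unfolding b_def abs_if by (metis Rats_minus_iff)

lemma b_pos: "b > 0"
  using b_irrational by (cases "b = 0") (auto simp: b_def)

lemma int_mult_b_Ints: "of_int k * b \<in> \<int> \<Longrightarrow> k = 0"
proof (rule ccontr)
  assume "of_int k * b \<in> \<int>" and "k \<noteq> 0"
  then have "of_int k * b / of_int k \<in> \<rat>"
    by (metis Ints_cases Rats_divide Rats_of_int)
  with \<open>k \<noteq> 0\<close> b_irrational show False by simp
qed

lemma represents_residue: "represents n (residue n)"
  by (simp add: represents_def residue_def)

lemma represents_0: "represents 0 0"
  by (simp add: represents_def)

lemma represents_add:
  assumes "represents m u" "represents n v"
  shows "represents (m + n) (u + v)"
proof -
  have "real (m + n) * b - (u + v) = (real m * b - u) + (real n * b - v)"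
    by (simp add: algebra_simps)
  with assms show ?thesis by (simp only: represents_def Ints_add)
qed

lemma represents_diff:
  assumes "represents m u" "represents n v" "n \<le> m"
  shows "represents (m - n) (u - v)"
proof -
  have "real (m - n) * b - (u - v) = (real m * b - u) - (real n * b - v)"
    using assms(3) by (simp add: of_nat_diff algebra_simps)
  with assms show ?thesis by (simp only: represents_def Ints_diff)
qed

lemma represents_mult:
  "represents n v \<Longrightarrow> represents (k * n) (of_nat k * v)"
proof (induction k)
  case (Suc k)
  from represents_add[OF Suc.prems Suc.IH[OF Suc.prems]] show ?case
    by (simp add: algebra_simps)
qed (simp add: represents_0)

lemma represents_unique:
  assumes "represents m v" "represents n v"
  shows "m = n"
proof -
  have "of_int (int m - int n) * b = (real m * b - v) - (real n * b - v)"
    by (simp add: algebra_simps)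
  with assms have "of_int (int m - int n) * b \<in> \<int>"
    by (simp only: represents_def Ints_diff)
  from int_mult_b_Ints[OF this] show ?thesis by simp
qed

text \<open>Indices add, so the two indices sum to the index of 0, which is 0. This excludes
  opposite numbers with positive indices.\<close>

lemma represents_uminus:
  assumes "represents m v" "represents n (- v)"
  shows "m = 0" "n = 0"
  using represents_unique[OF represents_add[OF assms], of 0] represents_0 by simp_all

lemma residue_le: "represents n v \<Longrightarrow> \<bar>residue n\<bar> \<le> \<bar>v\<bar>"
proof -
  assume "represents n v"
  then obtain m where "real n * b - v = of_int m"
    by (auto simp: represents_def Ints_def)
  then have "v = real n * b - of_int m" by simp
  then show ?thesis unfolding residue_def using round_diff_minimal by simp
qed

lemma residue_nonzero: "0 < n \<Longrightarrow> residue n \<noteq> 0"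
  using represents_residue[of n] represents_unique[OF _ represents_0, of n] by auto

section \<open>Records of the distance to the nearest integer\<close>

lemma residue_small:
  assumes "\<epsilon> > 0"
  obtains n where "0 < n" "\<bar>residue n\<bar> < \<epsilon>"
proof -
  obtain N :: nat where N: "N > 0" "1 / N < \<epsilon>"
    by (metis assms gr_zeroI inverse_eq_divide real_arch_inverse)
  obtain h k where hk: "0 < k" "\<bar>of_int k * b - of_int h\<bar> < 1 / N"
    using Dirichlet_approx[OF N(1)] by metis
  have "represents (nat k) (of_int k * b - of_int h)"
    using hk(1) by (simp add: represents_def)
  then have "\<bar>residue (nat k)\<bar> < \<epsilon>"
    using residue_le hk(2) N(2) by fastforce
  with hk(1) show thesis using that[of "nat k"] by simp
qed

text \<open>These are the denominators of the continued fraction convergents of \<open>b\<close>,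
  each listed once, obtained from minimality instead of the usual recursion.\<close>

primrec q :: "nat \<Rightarrow> nat" where
  "q 0 = 1"
| "q (Suc k) = (LEAST n. q k < n \<and> \<bar>residue n\<bar> < \<bar>residue (q k)\<bar>)"

declare q.simps(2) [simp del]

abbreviation \<beta> :: "nat \<Rightarrow> real" where "\<beta> k \<equiv> residue (q k)"

text \<open>Dirichlet approximation yields a smaller residue, and the record hypothesis places it
  beyond \<open>q k\<close>, so the \<open>LEAST\<close> is attained. The last bound is weak because
  \<open>n = q k\<close> is allowed.\<close>

lemma q_step:
  assumes "0 < q k" "\<And>n. 0 < n \<Longrightarrow> n < q k \<Longrightarrow> \<bar>\<beta> k\<bar> < \<bar>residue n\<bar>"
  shows "q k < q (Suc k)" "\<bar>\<beta> (Suc k)\<bar> < \<bar>\<beta> k\<bar>"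
    and "\<And>n. 0 < n \<Longrightarrow> n < q (Suc k) \<Longrightarrow> \<bar>\<beta> k\<bar> \<le> \<bar>residue n\<bar>"
proof -
  let ?P = "\<lambda>n. q k < n \<and> \<bar>residue n\<bar> < \<bar>residue (q k)\<bar>"
  obtain n where n: "0 < n" "\<bar>residue n\<bar> < \<bar>\<beta> k\<bar>"
    using residue_small[of "\<bar>\<beta> k\<bar>"] residue_nonzero[OF assms(1)] by auto
  then have "?P n" using assms(2)[of n] by (metis less_asym less_irrefl linorder_neqE_nat)
  then have P: "?P (q (Suc k))" unfolding q.simps(2) by (rule LeastI)
  then show "q k < q (Suc k)" "\<bar>\<beta> (Suc k)\<bar> < \<bar>\<beta> k\<bar>" by blast+
  show "\<bar>\<beta> k\<bar> \<le> \<bar>residue n\<bar>" if "0 < n" "n < q (Suc k)" for n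
    using not_less_Least[OF that(2)[unfolded q.simps(2)]] assms(2)[OF that(1)]
    by (metis leI less_imp_le linorder_neqE_nat order_refl)
qed

lemma q_pos_record:
  "0 < q k \<and> (\<forall>n. 0 < n \<and> n < q k \<longrightarrow> \<bar>\<beta> k\<bar> < \<bar>residue n\<bar>)"
proof (induction k)
  case (Suc k)
  then have h: "0 < q k" "\<And>n. 0 < n \<Longrightarrow> n < q k \<Longrightarrow> \<bar>\<beta> k\<bar> < \<bar>residue n\<bar>" by auto
  show ?case using q_step[OF h] h(1) by (metis order_less_le_trans order_less_trans)
qed simp

lemma q_pos: "0 < q k"
  and q_record: "0 < n \<Longrightarrow> n < q k \<Longrightarrow> \<bar>\<beta> k\<bar> < \<bar>residue n\<bar>"
  using q_pos_record by auto

lemma q_less_Suc: "q k < q (Suc k)"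
  and \<beta>_Suc_less: "\<bar>\<beta> (Suc k)\<bar> < \<bar>\<beta> k\<bar>"
  and \<beta>_le_residue: "0 < n \<Longrightarrow> n < q (Suc k) \<Longrightarrow> \<bar>\<beta> k\<bar> \<le> \<bar>residue n\<bar>"
proof -
  have r: "\<bar>\<beta> k\<bar> < \<bar>residue n\<bar>" if "0 < n" "n < q k" for n
    using q_record[OF that] .
  show "q k < q (Suc k)" "\<bar>\<beta> (Suc k)\<bar> < \<bar>\<beta> k\<bar>"
    by (rule q_step(1)[OF q_pos r] q_step(2)[OF q_pos r]; assumption)+
  show "\<bar>\<beta> k\<bar> \<le> \<bar>residue n\<bar>" if "0 < n" "n < q (Suc k)" for n
    by (rule q_step(3)[OF q_pos r that])
qed

lemma strict_mono_q: "strict_mono q"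
  by (simp add: strict_mono_Suc_iff q_less_Suc)

lemma \<beta>_nonzero: "\<beta> k \<noteq> 0"
  by (simp add: residue_nonzero q_pos)

lemma \<beta>_le:
  assumes "represents n v" "0 < n" "n < q (Suc k)"
  shows "\<bar>\<beta> k\<bar> \<le> \<bar>v\<bar>"
  using \<beta>_le_residue[OF assms(2,3)] residue_le[OF assms(1)] by linarith

text \<open>Let \<open>q j\<close> be the last one with \<open>q j \<le> p\<close>. If
  \<open>q j < p < q (Suc j)\<close>, then \<open>p\<close> could not improve on \<open>q j\<close>,
  contradicting that \<open>p\<close> is a record.\<close>

lemma record_eq_q:
  assumes "0 < p" "\<And>n. 0 < n \<Longrightarrow> n < p \<Longrightarrow> \<bar>residue p\<bar> < \<bar>residue n\<bar>"
  shows "\<exists>k. p = q k"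
proof -
  have ex: "\<exists>k. p < q k"
    using strict_mono_imp_increasing[OF strict_mono_q, of "Suc p"] Suc_le_eq by blast
  define k where "k = (LEAST k. p < q k)"
  have k: "p < q k" unfolding k_def using ex by (rule LeastI_ex)
  have "k \<noteq> 0" using k assms(1) by (metis less_one not_gr_zero q.simps(1))
  then obtain j where j: "k = Suc j" by (cases k) auto
  have "q j \<le> p" using not_less_Least[of j "\<lambda>k. p < q k"] j k_def by simp
  moreover have "\<not> q j < p"
    using \<beta>_le_residue[of p j] assms(1) assms(2)[of "q j"] k j q_pos[of j] by auto
  ultimately show ?thesis by auto
qed

text \<open>If two consecutive residues had the same sign, their difference would be too good an
  approximation.\<close>

lemma \<beta>_alternates: "\<beta> k > 0 \<longleftrightarrow> \<beta> (Suc k) < 0"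
proof -
  have r: "represents (q (Suc k) - q k) (\<beta> (Suc k) - \<beta> k)"
    by (intro represents_diff represents_residue less_imp_le q_less_Suc)
  have "\<bar>\<beta> k\<bar> \<le> \<bar>\<beta> (Suc k) - \<beta> k\<bar>"
    by (rule \<beta>_le[OF r]) (use q_less_Suc q_pos in auto)
  then show ?thesis using \<beta>_Suc_less[of k] \<beta>_nonzero[of k] \<beta>_nonzero[of "Suc k"] by linarith
qed

text \<open>The residues at \<open>k\<close> and \<open>k + 2\<close> have equal signs, so their
  difference has absolute value below \<open>\<bar>\<beta> k\<bar>\<close>. Hence its index is at
  least \<open>q (Suc k)\<close>; being below \<open>q (Suc (Suc k))\<close>, that index also forces
  the value to be at least \<open>\<bar>\<beta> (Suc k)\<bar>\<close>.\<close>

lemma q_add_le: "q k + q (Suc k) \<le> q (Suc (Suc k))"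
  and \<beta>_add_le: "\<bar>\<beta> (Suc k)\<bar> + \<bar>\<beta> (Suc (Suc k))\<bar> \<le> \<bar>\<beta> k\<bar>"
proof -
  let ?n = "q (Suc (Suc k)) - q k" and ?v = "\<beta> (Suc (Suc k)) - \<beta> k"
  have lt: "q k < q (Suc (Suc k))" using q_less_Suc by (meson less_trans)
  have r: "represents ?n ?v"
    by (intro represents_diff represents_residue less_imp_le lt)
  have v: "\<bar>?v\<bar> = \<bar>\<beta> k\<bar> - \<bar>\<beta> (Suc (Suc k))\<bar>"
    using \<beta>_alternates[of k] \<beta>_alternates[of "Suc k"] \<beta>_nonzero[of k] \<beta>_nonzero[of "Suc k"]
      \<beta>_nonzero[of "Suc (Suc k)"] \<beta>_Suc_less[of k] \<beta>_Suc_less[of "Suc k"] by linarith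
  show "\<bar>\<beta> (Suc k)\<bar> + \<bar>\<beta> (Suc (Suc k))\<bar> \<le> \<bar>\<beta> k\<bar>"
    using \<beta>_le[OF r, of "Suc k"] lt q_pos[of k] v by simp
  have "\<not> ?n < q (Suc k)"
    using \<beta>_le[OF r, of k] lt v \<beta>_nonzero[of "Suc (Suc k)"] by auto
  then show "q k + q (Suc k) \<le> q (Suc (Suc k))" using lt by linarith
qed

section \<open>The records of positive residue and their negative predecessors\<close>

definition pos_record :: "nat \<Rightarrow> bool" where
  "pos_record p \<longleftrightarrow> 1 < p \<and> 0 < residue p \<and>
     (\<forall>n. 0 < n \<and> n < p \<longrightarrow> \<bar>residue p\<bar> < \<bar>residue n\<bar>)"

text \<open>The position of the first negative residue. By alternation the negative records sit at
  \<open>k0 + 2 * i\<close>, so each \<open>P i\<close> comes right after a negative record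
  \<open>S i\<close>.\<close>

definition k0 :: nat where "k0 = (if \<beta> 0 < 0 then 0 else 1)"

definition P :: "nat \<Rightarrow> nat" where "P i = q (k0 + 2 * i + 1)"

definition S :: "nat \<Rightarrow> nat" where "S i = q (k0 + 2 * i)"

abbreviation w :: "nat \<Rightarrow> real" where "w i \<equiv> residue (P i)"

text \<open>This number plays two roles: it bounds the tail of the weights from \<open>i\<close> on,
  and it is the least distance between distinct numbers, not differing by an integer, of index below
  \<open>P i\<close>.\<close>

abbreviation f :: "nat \<Rightarrow> real" where "f i \<equiv> - residue (S i)"

lemma \<beta>_neg_iff: "\<beta> k < 0 \<longleftrightarrow> even k = even k0"
proof (induction k)
  case (Suc k)
  then show ?case using \<beta>_alternates[of k] \<beta>_nonzero[of k] by fastforce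
qed (simp add: k0_def)

lemma w_pos: "0 < w i" and f_pos: "0 < f i"
proof -
  show "0 < w i"
    using \<beta>_neg_iff[of "k0 + 2 * i + 1"] \<beta>_nonzero[of "k0 + 2 * i + 1"]
    unfolding P_def by (simp add: not_less order.strict_iff_order)
  show "0 < f i"
    using \<beta>_neg_iff[of "k0 + 2 * i"] unfolding S_def by simp
qed

lemma S_less_P: "S i < P i" and S_pos: "0 < S i"
  using q_less_Suc q_pos by (auto simp: P_def S_def)

lemma S_Suc_ge: "S i + P i \<le> S (Suc i)"
  using q_add_le[of "k0 + 2 * i"] by (simp add: P_def S_def)

lemma w_add_f_le: "w i + f (Suc i) \<le> f i"
  using \<beta>_add_le[of "k0 + 2 * i"] w_pos[of i] f_pos[of i] f_pos[of "Suc i"]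
  by (simp add: P_def S_def)

lemma f_Suc_less: "f (Suc i) < w i"
  using \<beta>_Suc_less[of "k0 + 2 * i + 1"] w_pos[of i] f_pos[of "Suc i"]
  by (simp add: P_def S_def)

lemma f_le:
  "represents n v \<Longrightarrow> 0 < n \<Longrightarrow> n < P i \<Longrightarrow> f i \<le> \<bar>v\<bar>"
  using \<beta>_le[of n v "k0 + 2 * i"] f_pos[of i] by (simp add: P_def S_def)

lemma strict_mono_P: "strict_mono P"
  unfolding strict_mono_Suc_iff
proof
  show "P i < P (Suc i)" for i
    using S_Suc_ge[of i] S_less_P[of "Suc i"] S_pos[of i] by linarith
qed

lemma pos_record_iff: "pos_record p \<longleftrightarrow> (\<exists>i. p = P i)"
proof
  assume p: "pos_record p"
  then have "0 < p" "\<And>n. 0 < n \<Longrightarrow> n < p \<Longrightarrow> \<bar>residue p\<bar> < \<bar>residue n\<bar>"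
    unfolding pos_record_def by (linarith, blast)
  then obtain k where k: "p = q k" using record_eq_q by blast
  \<comment> \<open>This excludes \<open>q 0\<close>, whose residue is positive when
    \<open>k0 = 1\<close>. The other positions of parity opposite to \<open>k0\<close> are all of
    the form \<open>k0 + 2 * i + 1\<close>.\<close>
  have "k \<noteq> 0" using p k by (intro notI) (simp add: pos_record_def)
  moreover have "even k \<noteq> even k0"
    using p k \<beta>_neg_iff[of k] by (simp add: pos_record_def)
  moreover have "k0 = 0 \<or> k0 = 1" by (simp add: k0_def)
  ultimately have "\<exists>i. k = k0 + 2 * i + 1" by presburger
  with k show "\<exists>i. p = P i" by (auto simp: P_def)
next
  assume "\<exists>i. p = P i"
  then obtain i where i: "p = P i" by blast
  have "1 < P i" using S_less_P[of i] S_pos[of i] by simp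
  moreover have "\<bar>residue (P i)\<bar> < \<bar>residue n\<bar>" if "0 < n" "n < P i" for n
    using q_record that by (simp add: P_def)
  ultimately show "pos_record p" using w_pos i by (simp add: pos_record_def)
qed

subsection \<open>Subset sums of best approximations\<close>

lemma residue_less_1: "\<bar>residue n\<bar> < 1"
proof -
  have "represents n (frac (real n * b))" by (simp add: represents_def frac_def)
  then show ?thesis using residue_le frac_lt_1[of "real n * b"] by fastforce
qed

lemma sum_w_le: "(\<Sum>j<n. w (j + i)) \<le> f i"
proof -
  \<comment> \<open>Keeping the term \<open>f (n + i)\<close> lets \<open>w_add_f_le\<close>
    telescope.\<close>
  have "(\<Sum>j<n. w (j + i)) \<le> f i - f (n + i)"
  proof (induction n)
    case (Suc n)
    then show ?case using w_add_f_le[of "n + i"] by simp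
  qed simp
  then show ?thesis using f_pos[of "n + i"] by linarith
qed

lemma summable_w: "summable w"
  using summableI_nonneg_bounded[of w "f 0"] w_pos sum_w_le[of 0] by (simp add: less_imp_le)

section \<open>Partial sums as truncations\<close>

definition weight :: "nat set \<Rightarrow> nat \<Rightarrow> real" where
  "weight X j = (if j \<in> X then w j else 0)"

definition total :: "nat set \<Rightarrow> real" where
  "total X = suminf (weight X)"

definition psum :: "nat set \<Rightarrow> nat \<Rightarrow> real" where
  "psum X i = (\<Sum>j<i. weight X j)"

lemma weight_bounds: "0 \<le> weight X j" "weight X j \<le> w j"
  using w_pos[of j] by (auto simp: weight_def)

lemma summable_weight: "summable (weight X)"
  by (rule summable_comparison_test'[OF summable_w]) (use weight_bounds in auto)

lemma psum_le_total: "psum X i \<le> total X"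
  unfolding psum_def total_def by (rule sum_le_suminf[OF summable_weight]) (auto simp: weight_bounds)

lemma total_le_psum_add: "total X \<le> psum X i + f i"
proof -
  have "(\<Sum>j<n. weight X (j + i)) \<le> f i" for n
    by (rule order_trans[OF sum_mono sum_w_le]) (rule weight_bounds)
  then have "(\<Sum>j. weight X (j + i)) \<le> f i"
    by (rule suminf_le_const[OF summable_ignore_initial_segment[OF summable_weight]])
  then show ?thesis
    using suminf_split_initial_segment[OF summable_weight, of X i]
    by (simp add: psum_def total_def)
qed

lemma psum_Suc: "psum X (Suc i) = psum X i + weight X i"
  by (simp add: psum_def)

text \<open>If \<open>i\<close> is not in \<open>X\<close>, the rest of the sum is at most
  \<open>f (Suc i)\<close>, which is less than \<open>w i\<close>. So comparison with the total
  reads off membership.\<close>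

lemma psum_add_w_le_iff: "psum X i + w i \<le> total X \<longleftrightarrow> i \<in> X"
proof (cases "i \<in> X")
  case True
  then show ?thesis using psum_le_total[of X "Suc i"] by (simp add: psum_Suc weight_def)
next
  case False
  then show ?thesis using total_le_psum_add[of X "Suc i"] f_Suc_less[of i]
    by (simp add: psum_Suc weight_def)
qed

text \<open>The index is the sum of the chosen \<open>P j\<close>, bounded through
  \<open>S_Suc_ge\<close>. Having \<open>S i\<close> as bound, and not just \<open>P i\<close>,
  rules out an index drop by \<open>S i\<close> in \<open>psum_greatest\<close>.\<close>

lemma represents_psum: "\<exists>n < S i. represents n (psum X i)"
proof -
  have "\<exists>n. n + S 0 \<le> S i \<and> represents n (psum X i)"
  proof (induction i)
    case 0
    then show ?case using represents_0 by (auto simp: psum_def)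
  next
    case (Suc i)
    then obtain n where n: "n + S 0 \<le> S i" "represents n (psum X i)" by blast
    have "represents (n + (if i \<in> X then P i else 0)) (psum X (Suc i))"
      unfolding psum_Suc weight_def
      using represents_add[OF n(2) represents_residue[of "P i"]] n(2) by simp
    moreover have "n + (if i \<in> X then P i else 0) + S 0 \<le> S (Suc i)"
      using n(1) S_Suc_ge[of i] by simp
    ultimately show ?case by blast
  qed
  then obtain n where "n + S 0 \<le> S i" "represents n (psum X i)" by blast
  moreover from this have "n < S i" using S_pos[of 0] by linarith
  ultimately show ?thesis by blast
qed

text \<open>Elements with indices below \<^term>\<open>P i\<close> are at least \<^term>\<open>f i\<close> apart, and attaining this gap
  from \<^term>\<open>psum X i\<close> upwards would lower the index by \<^term>\<open>S i\<close>, making it negative.\<close>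

lemma psum_greatest:
  assumes "represents m u" "m < P i" "u \<le> total X"
  shows "u \<le> psum X i"
proof (rule ccontr)
  assume "\<not> u \<le> psum X i"
  then have gt: "psum X i < u" by simp
  obtain n where n: "n < S i" "represents n (psum X i)" using represents_psum by blast
  have le: "u - psum X i \<le> f i" using assms(3) total_le_psum_add[of X i] by linarith
  consider "m = n" | "n < m" | "m < n" by linarith
  then show False
  proof cases
    case 1
    \<comment> \<open>Equal indices make the difference an integer, yet it lies strictly between 0
      and 1.\<close>
    have "represents 0 (u - psum X i)"
      using represents_diff[OF assms(1) n(2)] 1 by simp
    then obtain k where k: "u - psum X i = of_int k"
      by (metis Ints_cases Ints_minus diff_0 minus_minus mult_zero_left of_nat_0 represents_def)
    moreover have "0 < u - psum X i" "u - psum X i < 1"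
      using gt le residue_less_1[of "S i"] by linarith+
    ultimately show False by simp
  next
    case 2
    have r: "represents (m - n) (u - psum X i)"
      using represents_diff[OF assms(1) n(2)] 2 by simp
    \<comment> \<open>\<open>f_le\<close> and the tail bound squeeze the gap to exactly
      \<open>f i\<close>. Then \<open>f i\<close> and \<open>- f i\<close> would have the positive
      indices \<open>m - n\<close> and \<open>S i\<close>.\<close>
    have "u - psum X i = f i"
      using f_le[OF r, of i] gt le 2 assms(2) by simp
    then have "represents (m - n) (f i)" using r by simp
    then show False using represents_uminus(1)[of "m - n" "f i" "S i"] represents_residue[of "S i"] 2
      by simp
  next
    case 3
    have r: "represents (n - m) (psum X i - u)"
      using represents_diff[OF n(2) assms(1)] 3 by simp
    have "n - m < P i" using n(1) S_less_P[of i] by linarith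
    \<comment> \<open>The same squeeze now forces an index drop of \<open>S i\<close>, which exceeds
      \<open>n\<close>.\<close>
    then have "psum X i - u = residue (S i)"
      using f_le[OF r, of i] gt le 3 by simp
    then have "n - m = S i" using represents_unique[OF _ represents_residue] r by metis
    then show False using n(1) by simp
  qed
qed

text \<open>Steps of length \<open>w i < c' - c\<close>, starting from the integer part of
  \<open>c\<close>, cannot jump over the interval, and the integer shift leaves the index
  unchanged.\<close>

lemma represents_dense:
  assumes "c < c'"
  obtains n t where "represents n t" "c < t" "t \<le> c'"
proof -
  have "w \<longlonglongrightarrow> 0" by (rule summable_LIMSEQ_zero[OF summable_w])
  then have "eventually (\<lambda>i. w i < c' - c) sequentially"
    using assms by (intro order_tendstoD) auto
  then obtain i where i: "w i < c' - c" by (auto simp: eventually_sequentially)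
  \<comment> \<open>The first number of steps that passes \<open>frac c\<close>.\<close>
  define k where "k = nat \<lfloor>frac c / w i\<rfloor> + 1"
  have "real k = of_int \<lfloor>frac c / w i\<rfloor> + 1"
    unfolding k_def using w_pos[of i] by (simp add: nat_add_distrib)
  then have "frac c / w i < real k" "real k \<le> frac c / w i + 1" by linarith+
  then have k: "frac c < real k * w i" "real k * w i \<le> frac c + w i"
    using w_pos[of i] by (simp_all add: field_simps)
  have "represents (k * P i) (real k * w i)"
    by (rule represents_mult[OF represents_residue])
  then have "represents (k * P i) (of_int \<lfloor>c\<rfloor> + real k * w i)"
    unfolding represents_def by (metis Ints_diff Ints_of_int diff_diff_add add.commute)
  moreover have "c < of_int \<lfloor>c\<rfloor> + real k * w i" "of_int \<lfloor>c\<rfloor> + real k * w i \<le> c'"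
    using k i by (simp_all add: frac_def)
  ultimately show thesis by (rule that)
qed

subsection \<open>The coding inside the structure\<close>

definition Za :: "real set" where
  "Za = {of_int z * a | z :: int. True}"

text \<open>The order on \<open>Za\<close> expresses the bound on the index: for
  \<open>p = n * b\<close>, the index of \<open>t\<close> is below \<open>n\<close>.\<close>

definition approx :: "real \<Rightarrow> real \<Rightarrow> bool" where
  "approx p t \<longleftrightarrow> (\<exists>x\<in>Za. 0 \<le> x \<and> x < p \<and> x - t \<in> \<int>)"

text \<open>\<open>lower p c t\<close>: \<open>t\<close> is the truncation of \<open>c\<close> at index \<open>p\<close>.\<close>

definition lower :: "real \<Rightarrow> real \<Rightarrow> real \<Rightarrow> bool" where
  "lower p c t \<longleftrightarrow> approx p t \<and> t \<le> c \<and> (\<forall>u. approx p u \<and> u \<le> c \<longrightarrow> u \<le> t)"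

text \<open>No rounding is expressed: \<open>u\<close> ranges over all reals congruent to
  \<open>x\<close>, and \<open>v\<close> is still forced to be the residue
  (\<open>precord_iff\<close>). The existential clause says that the index of \<open>p\<close>
  exceeds 1.\<close>

definition precord :: "real \<Rightarrow> real \<Rightarrow> bool" where
  "precord p v \<longleftrightarrow> p \<in> Za \<and> 0 < v \<and> p - v \<in> \<int> \<and> (\<exists>x\<in>Za. 0 < x \<and> x < p) \<and>
     (\<forall>x\<in>Za. 0 < x \<longrightarrow> (\<forall>u. x < p \<and> x - u \<in> \<int> \<longrightarrow> v < \<bar>u\<bar>))"

definition marker :: "real \<Rightarrow> bool" where
  "marker p \<longleftrightarrow> (\<exists>v. precord p v)"

definition first_marker :: "real \<Rightarrow> bool" where
  "first_marker p \<longleftrightarrow> marker p \<and> (\<forall>r. marker r \<longrightarrow> p \<le> r)"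

definition next_marker :: "real \<Rightarrow> real \<Rightarrow> bool" where
  "next_marker p r \<longleftrightarrow> marker p \<and> marker r \<and> p < r \<and> (\<forall>x. marker x \<and> p < x \<longrightarrow> r \<le> x)"

text \<open>The recursion for partial sums, started at the empty sum 0, is imposed on the
  truncations of \<open>c\<close>; this characterizes subset sums without mentioning infinite
  sums.\<close>

definition code :: "real \<Rightarrow> bool" where
  "code c \<longleftrightarrow> (\<forall>p. first_marker p \<longrightarrow> lower p c 0) \<and>
     (\<forall>p r v t. next_marker p r \<and> precord p v \<and> lower p c t \<longrightarrow>
        lower r c (if t + v \<le> c then t + v else t))"

definition digit :: "real \<Rightarrow> real \<Rightarrow> bool" where
  "digit p c \<longleftrightarrow> (\<exists>v t. precord p v \<and> lower p c t \<and> t + v \<le> c)"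

section \<open>Markers and truncations in terms of indices\<close>

definition mark :: "nat \<Rightarrow> real" where
  "mark i = real (P i) * b"

lemma Za_nonneg_iff: "x \<in> Za \<and> 0 \<le> x \<longleftrightarrow> (\<exists>n. x = real n * b)"
proof
  assume x: "x \<in> Za \<and> 0 \<le> x"
  then obtain z :: int where z: "x = of_int z * a" by (auto simp: Za_def)
  with x have "x = real (nat \<bar>z\<bar>) * b"
    by (simp add: b_def flip: abs_mult)
  then show "\<exists>n. x = real n * b" by blast
next
  assume "\<exists>n. x = real n * b"
  then obtain n where n: "x = real n * b" by blast
  have "x = of_int (if 0 \<le> a then int n else - int n) * a"
    by (simp add: n b_def)
  then have "x \<in> Za" unfolding Za_def by blast
  then show "x \<in> Za \<and> 0 \<le> x" using n b_pos by simp
qed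

lemma Bex_Za_nonneg: "(\<exists>x\<in>Za. 0 \<le> x \<and> Q x) \<longleftrightarrow> (\<exists>n. Q (real n * b))"
  unfolding Bex_def conj_assoc[symmetric] Za_nonneg_iff by auto

lemma Za_pos_iff: "x \<in> Za \<and> 0 < x \<longleftrightarrow> (\<exists>n>0. x = real n * b)"
proof -
  have "x \<in> Za \<and> 0 < x \<longleftrightarrow> (x \<in> Za \<and> 0 \<le> x) \<and> x \<noteq> 0" by auto
  also have "\<dots> \<longleftrightarrow> (\<exists>n>0. x = real n * b)"
    unfolding Za_nonneg_iff using b_pos by auto
  finally show ?thesis .
qed

lemma Bex_Za_pos: "(\<exists>x\<in>Za. 0 < x \<and> Q x) \<longleftrightarrow> (\<exists>n>0. Q (real n * b))"
  unfolding Bex_def conj_assoc[symmetric] Za_pos_iff by auto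

lemma Ball_Za_pos: "(\<forall>x\<in>Za. 0 < x \<longrightarrow> Q x) \<longleftrightarrow> (\<forall>n>0. Q (real n * b))"
  using Bex_Za_pos[of "\<lambda>x. \<not> Q x"] by auto

lemma index_less_iff: "real m * b < real n * b \<longleftrightarrow> m < n"
  using b_pos by simp

lemma approx_iff: "approx (real p * b) t \<longleftrightarrow> (\<exists>n<p. represents n t)"
  unfolding approx_def Bex_Za_nonneg represents_def index_less_iff ..

lemma precord_iff: "precord x v \<longleftrightarrow> (\<exists>i. x = mark i \<and> v = w i)"
proof -
  have aux: "precord (real p * b) v \<longleftrightarrow> pos_record p \<and> v = residue p" if "p > 0" for p v
  proof -
    have "precord (real p * b) v \<longleftrightarrow> 0 < v \<and> represents p v \<and> 1 < p \<and>
        (\<forall>n>0. \<forall>u. n < p \<and> represents n u \<longrightarrow> v < \<bar>u\<bar>)"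
    proof -
      have "real p * b \<in> Za" using Za_nonneg_iff by blast
      moreover have "(\<exists>n>0. n < p) \<longleftrightarrow> 1 < p" by auto
      ultimately show ?thesis
        unfolding precord_def Bex_Za_pos Ball_Za_pos index_less_iff represents_def by simp
    qed
    also have "\<dots> \<longleftrightarrow> pos_record p \<and> v = residue p"
    proof
      assume *: "0 < v \<and> represents p v \<and> 1 < p \<and>
        (\<forall>n>0. \<forall>u. n < p \<and> represents n u \<longrightarrow> v < \<bar>u\<bar>)"
      then have r: "v < \<bar>residue n\<bar>" if "0 < n" "n < p" for n
        using represents_residue that by blast
      have le: "\<bar>residue p\<bar> \<le> v" using * residue_le[of p v] by simp
      \<comment> \<open>Index 1 is among those tested because \<open>1 < p\<close>. With
        \<open>v < 1/2\<close>, the integer \<open>v - residue p\<close> has absolute value below 1,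
        so it is 0.\<close>
      have half: "v < 1/2"
      proof -
        have "\<bar>residue 1\<bar> \<le> 1/2" unfolding residue_def using of_int_round_abs_le
          by (metis abs_minus_commute)
        then show ?thesis using r[of 1] * by simp
      qed
      have "represents 0 (residue p - v)"
        using represents_diff[of p "residue p" p v] * represents_residue by simp
      then have "v - residue p \<in> \<int>" by (simp add: represents_def)
      then obtain k where "v - residue p = of_int k" by (auto elim: Ints_cases)
      moreover have "- 1 < v - residue p" "v - residue p < 1" using le half by linarith+
      ultimately have "v = residue p" by (cases "k = 0") (simp, linarith)
      with * r show "pos_record p \<and> v = residue p" by (auto simp: pos_record_def)
    next
      assume *: "pos_record p \<and> v = residue p"
      then have "v < \<bar>u\<bar>" if "n > 0" "n < p" "represents n u" for n u
        using residue_le[OF that(3)] that by (fastforce simp: pos_record_def)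
      with * show "0 < v \<and> represents p v \<and> 1 < p \<and>
        (\<forall>n>0. \<forall>u. n < p \<and> represents n u \<longrightarrow> v < \<bar>u\<bar>)"
        using represents_residue by (auto simp: pos_record_def)
    qed
    finally show ?thesis .
  qed
  show ?thesis
  proof
    assume x: "precord x v"
    then have "x \<in> Za \<and> 0 < x" by (auto simp: precord_def)
    then obtain p where "p > 0" "x = real p * b" unfolding Za_pos_iff by blast
    with x aux show "\<exists>i. x = mark i \<and> v = w i"
      unfolding pos_record_iff mark_def by blast
  next
    assume "\<exists>i. x = mark i \<and> v = w i"
    then obtain i where "x = mark i" "v = w i" by blast
    moreover have "P i > 0" using S_less_P[of i] by simp
    ultimately show "precord x v" using aux[of "P i" v] pos_record_iff by (auto simp: mark_def)
  qed
qed

lemma mark_less_iff [simp]: "mark i < mark j \<longleftrightarrow> i < j"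
  using b_pos strict_mono_less[OF strict_mono_P] by (simp add: mark_def)

lemma mark_le_iff [simp]: "mark i \<le> mark j \<longleftrightarrow> i \<le> j"
  using mark_less_iff[of j i] by (simp only: not_less[symmetric])

lemma mark_eq_iff [simp]: "mark i = mark j \<longleftrightarrow> i = j"
  by (metis mark_less_iff less_irrefl linorder_neqE_nat)

lemma marker_iff: "marker x \<longleftrightarrow> (\<exists>i. x = mark i)"
  by (auto simp: marker_def precord_iff)

lemma first_marker_iff: "first_marker x \<longleftrightarrow> x = mark 0"
proof -
  have "(\<forall>j. i \<le> j) \<longleftrightarrow> i = 0" for i :: nat by auto
  then show ?thesis unfolding first_marker_def marker_iff by (metis mark_le_iff)
qed

lemma next_marker_iff: "next_marker x y \<longleftrightarrow> (\<exists>i. x = mark i \<and> y = mark (Suc i))"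
proof
  assume "next_marker x y"
  then obtain i j where ij: "x = mark i" "y = mark j" "i < j" and "mark j \<le> mark (Suc i)"
    unfolding next_marker_def marker_iff by (metis lessI mark_less_iff)
  then have "j = Suc i" by simp
  with ij show "\<exists>i. x = mark i \<and> y = mark (Suc i)" by blast
next
  assume "\<exists>i. x = mark i \<and> y = mark (Suc i)"
  then show "next_marker x y" by (auto simp: next_marker_def marker_iff)
qed

lemma lower_unique: "lower p c t \<Longrightarrow> lower p c u \<Longrightarrow> t = u"
  unfolding lower_def by (meson order.antisym)

lemma code_iff:
  "code c \<longleftrightarrow> lower (mark 0) c 0 \<and>
     (\<forall>i t. lower (mark i) c t \<longrightarrow> lower (mark (Suc i)) c (if t + w i \<le> c then t + w i else t))"
proof -
  have "(\<forall>p r v t. next_marker p r \<and> precord p v \<and> L p t \<longrightarrow> Q r v t) \<longleftrightarrow>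
      (\<forall>i t. L (mark i) t \<longrightarrow> Q (mark (Suc i)) (w i) t)" for L :: "real \<Rightarrow> real \<Rightarrow> bool" and Q
    unfolding next_marker_iff precord_iff by (rule iffI, blast, auto)
  then show ?thesis unfolding code_def first_marker_iff by simp
qed

lemma digit_iff: "digit (mark i) c \<longleftrightarrow> (\<exists>t. lower (mark i) c t \<and> t + w i \<le> c)"
  by (auto simp: digit_def precord_iff)

section \<open>Every set has exactly one code\<close>

lemma lower_total: "lower (mark i) (total X) (psum X i)"
proof -
  have "approx (mark i) (psum X i)"
    unfolding mark_def approx_iff using represents_psum[of i X] S_less_P[of i]
    by (meson less_trans)
  moreover have "u \<le> psum X i" if "approx (mark i) u" "u \<le> total X" for u
    using that psum_greatest unfolding mark_def approx_iff by blast
  ultimately show ?thesis unfolding lower_def using psum_le_total by blast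
qed

lemma digit_total: "digit (mark i) (total X) \<longleftrightarrow> i \<in> X"
  unfolding digit_iff using lower_total lower_unique psum_add_w_le_iff by blast

lemma code_total: "code (total X)"
  unfolding code_iff
proof (intro conjI allI impI)
  show "lower (mark 0) (total X) 0" using lower_total[of 0 X] by (simp add: psum_def)
next
  fix i t
  assume "lower (mark i) (total X) t"
  then have t: "t = psum X i" using lower_unique lower_total by blast
  have "(if t + w i \<le> total X then t + w i else t) = psum X (Suc i)"
    unfolding t psum_add_w_le_iff by (simp add: psum_Suc weight_def)
  then show "lower (mark (Suc i)) (total X) (if t + w i \<le> total X then t + w i else t)"
    using lower_total by simp
qed

text \<open>Both recursions start at 0, and equal digits select the same next truncation.\<close>

lemma code_lower:
  assumes "code c" "code c'" "\<And>i. digit (mark i) c \<longleftrightarrow> digit (mark i) c'"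
  shows "\<exists>t. lower (mark i) c t \<and> lower (mark i) c' t"
proof (induction i)
  case 0
  then show ?case using assms(1,2) unfolding code_iff by blast
next
  case (Suc i)
  then obtain t where t: "lower (mark i) c t" "lower (mark i) c' t" by blast
  then have "t + w i \<le> c \<longleftrightarrow> t + w i \<le> c'"
    using assms(3)[of i] lower_unique unfolding digit_iff by blast
  then show ?case using assms(1,2) t unfolding code_iff by metis
qed

text \<open>Otherwise some \<open>t\<close> in the interval from \<open>c\<close> to
  \<open>c'\<close> has an index \<open>n\<close>. At a marker beyond \<open>n\<close> the common
  truncation \<open>u\<close> satisfies \<open>t \<le> u\<close> as seen from \<open>c'\<close>, and
  \<open>u \<le> c < t\<close> as seen from \<open>c\<close>.\<close>

lemma code_le:
  assumes "code c" "code c'" "\<And>i. digit (mark i) c \<longleftrightarrow> digit (mark i) c'"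
  shows "c' \<le> c"
proof (rule ccontr)
  assume "\<not> c' \<le> c"
  then obtain n t where t: "represents n t" "c < t" "t \<le> c'"
    using represents_dense[of c c'] by auto
  obtain u where u: "lower (mark (Suc n)) c u" "lower (mark (Suc n)) c' u"
    using code_lower[OF assms] by blast
  have "n < P (Suc n)"
    using strict_mono_imp_increasing[OF strict_mono_P, of "Suc n"] by simp
  then have "approx (mark (Suc n)) t" unfolding mark_def approx_iff using t(1) by blast
  then show False using u t unfolding lower_def by fastforce
qed

lemma code_inject:
  assumes "code c" "code c'" "\<And>i. digit (mark i) c \<longleftrightarrow> digit (mark i) c'"
  shows "c = c'"
  using code_le[OF assms] code_le[OF assms(2,1)] assms(3) by (simp add: order.antisym)

end

subsection \<open>Formulas\<close>

abbreviation "fLe i t \<equiv> Neg (Less t i)"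
abbreviation "fImp p q \<equiv> Neg (And p (Neg q))"
abbreviation "fAll i p \<equiv> Neg (Ex i (Neg p))"
abbreviation "fPos i \<equiv> Less (Var i) (Add (Var i) (Var i))"

text \<open>The bound variables of each formula are fixed numbers; a formula is only used with
  arguments different from them. In the absence of constants, \<open>x < 0\<close> is expressed by
  \<open>x + x < x\<close>.\<close>

definition fCong :: "nat \<Rightarrow> nat \<Rightarrow> fml" where
  "fCong i j = Ex 10 (And (InZ (Var 10)) (Eq (Var i) (Add (Var j) (Var 10))))"

definition fApprox :: "nat \<Rightarrow> nat \<Rightarrow> fml" where
  "fApprox p t = Ex 11 (And (InZa (Var 11)) (And (fLe (Var 11) (Add (Var 11) (Var 11)))
     (And (Less (Var 11) (Var p)) (fCong 11 t))))"

definition fLower :: "nat \<Rightarrow> nat \<Rightarrow> nat \<Rightarrow> fml" where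
  "fLower p c t = And (fApprox p t) (And (fLe (Var t) (Var c))
     (fAll 12 (fImp (And (fApprox p 12) (fLe (Var 12) (Var c))) (fLe (Var 12) (Var t)))))"

text \<open>For \<open>v > 0\<close>, the condition \<open>v < \<bar>u\<bar>\<close> is rendered as
  \<open>u \<le> v \<longrightarrow> v + u < 0\<close>.\<close>

definition fPrecord :: "nat \<Rightarrow> nat \<Rightarrow> fml" where
  "fPrecord p v = And (InZa (Var p)) (And (fPos v) (And (fCong p v)
     (And (Ex 11 (And (InZa (Var 11)) (And (fPos 11) (Less (Var 11) (Var p)))))
       (fAll 11 (fImp (InZa (Var 11)) (fImp (fPos 11)
         (fAll 12 (fImp (And (Less (Var 11) (Var p)) (fCong 11 12))
           (fImp (fLe (Var 12) (Var v))
             (Less (Add (Add (Var v) (Var 12)) (Add (Var v) (Var 12))) (Add (Var v) (Var 12))))))))))))"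

definition fMarker :: "nat \<Rightarrow> fml" where
  "fMarker p = Ex 13 (fPrecord p 13)"

definition fFirst :: "nat \<Rightarrow> fml" where
  "fFirst p = And (fMarker p) (fAll 14 (fImp (fMarker 14) (fLe (Var p) (Var 14))))"

definition fNext :: "nat \<Rightarrow> nat \<Rightarrow> fml" where
  "fNext p r = And (fMarker p) (And (fMarker r) (And (Less (Var p) (Var r))
     (fAll 14 (fImp (And (fMarker 14) (Less (Var p) (Var 14))) (fLe (Var r) (Var 14))))))"

text \<open>\<open>fLower\<close> takes variables only, so 0 is named as the solution of
  \<open>x + x = x\<close>, and variable 19 names \<open>t + v\<close>. The conditional becomes two
  implications.\<close>

definition fCode :: "nat \<Rightarrow> fml" where
  "fCode c = And
     (fAll 15 (fImp (fFirst 15) (Ex 16 (And (Eq (Add (Var 16) (Var 16)) (Var 16)) (fLower 15 c 16)))))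
     (fAll 15 (fAll 16 (fAll 17 (fAll 18
       (fImp (And (fNext 15 16) (And (fPrecord 15 17) (fLower 15 c 18)))
         (And (fImp (fLe (Add (Var 18) (Var 17)) (Var c))
                 (Ex 19 (And (Eq (Var 19) (Add (Var 18) (Var 17))) (fLower 16 c 19))))
              (fImp (Less (Var c) (Add (Var 18) (Var 17))) (fLower 16 c 18))))))))"

definition fDigit :: "nat \<Rightarrow> nat \<Rightarrow> fml" where
  "fDigit p c = Ex 17 (Ex 18 (And (fPrecord p 17) (And (fLower p c 18)
     (fLe (Add (Var 18) (Var 17)) (Var c)))))"

lemma free_vars_fCong [simp]: "i \<noteq> 10 \<Longrightarrow> j \<noteq> 10 \<Longrightarrow> free_vars (fCong i j) = {i, j}"
  by (auto simp: fCong_def)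

lemma free_vars_fApprox [simp]:
  "p \<noteq> 11 \<Longrightarrow> t \<notin> {10, 11} \<Longrightarrow> free_vars (fApprox p t) = {p, t}"
  by (auto simp: fApprox_def)

lemma free_vars_fLower [simp]:
  "p \<notin> {11, 12} \<Longrightarrow> c \<noteq> 12 \<Longrightarrow> t \<notin> {10, 11, 12} \<Longrightarrow> free_vars (fLower p c t) = {p, c, t}"
  by (auto simp: fLower_def)

lemma free_vars_fPrecord [simp]:
  "p \<notin> {10, 11, 12} \<Longrightarrow> v \<notin> {10, 11, 12} \<Longrightarrow> free_vars (fPrecord p v) = {p, v}"
  by (auto simp: fPrecord_def)

lemma free_vars_fMarker [simp]: "p \<notin> {10, 11, 12, 13} \<Longrightarrow> free_vars (fMarker p) = {p}"
  by (auto simp: fMarker_def)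

lemma free_vars_fFirst [simp]: "p \<notin> {10, 11, 12, 13, 14} \<Longrightarrow> free_vars (fFirst p) = {p}"
  by (auto simp: fFirst_def)

lemma free_vars_fNext [simp]:
  "p \<notin> {10, 11, 12, 13, 14} \<Longrightarrow> r \<notin> {10, 11, 12, 13, 14} \<Longrightarrow> free_vars (fNext p r) = {p, r}"
  by (auto simp: fNext_def)

lemma free_vars_fCode [simp]: "c < 10 \<Longrightarrow> free_vars (fCode c) = {c}"
  by (auto simp: fCode_def)

lemma free_vars_fDigit [simp]: "p < 10 \<Longrightarrow> c < 10 \<Longrightarrow> free_vars (fDigit p c) = {p, c}"
  by (auto simp: fDigit_def)

section \<open>Meaning of the formulas in the structure\<close>

context irrational
begin

lemma sat_fCong [simp]:
  "i \<noteq> 10 \<Longrightarrow> j \<noteq> 10 \<Longrightarrow> sat a e (fCong i j) \<longleftrightarrow> e i - e j \<in> \<int>"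
  by (auto simp: fCong_def Bex_def[symmetric]) (metis add_diff_cancel_left' diff_add_cancel add.commute)+

lemma sat_InZa [simp]: "sat a e (InZa t) \<longleftrightarrow> trm_val e t \<in> Za"
  by (simp add: Za_def)

declare sat.simps(4) [simp del]

lemma sat_fApprox [simp]:
  "p \<noteq> 11 \<Longrightarrow> t \<notin> {10, 11} \<Longrightarrow> sat a e (fApprox p t) \<longleftrightarrow> approx (e p) (e t)"
  by (auto simp: fApprox_def approx_def not_less)

lemma sat_fLower [simp]:
  "p \<notin> {11, 12} \<Longrightarrow> c \<noteq> 12 \<Longrightarrow> t \<notin> {10, 11, 12} \<Longrightarrow>
     sat a e (fLower p c t) \<longleftrightarrow> lower (e p) (e c) (e t)"
  by (auto simp: fLower_def lower_def not_less)

lemma sat_fPrecord [simp]: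
  "p \<notin> {10, 11, 12} \<Longrightarrow> v \<notin> {10, 11, 12} \<Longrightarrow>
     sat a e (fPrecord p v) \<longleftrightarrow> precord (e p) (e v)"
proof -
  have *: "v < \<bar>u\<bar> \<longleftrightarrow> (u \<le> v \<longrightarrow> v + u < 0)" if "0 < v" for u v :: real
    using that by linarith
  have eq: "precord x v \<longleftrightarrow> x \<in> Za \<and> 0 < v \<and> x - v \<in> \<int> \<and> (\<exists>y\<in>Za. 0 < y \<and> y < x) \<and>
     (\<forall>y\<in>Za. 0 < y \<longrightarrow> (\<forall>u. y < x \<and> y - u \<in> \<int> \<longrightarrow> u \<le> v \<longrightarrow> v + u < 0))" for x v
    by (cases "0 < v") (simp_all add: precord_def *)
  assume "p \<notin> {10, 11, 12}" "v \<notin> {10, 11, 12}"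
  then show ?thesis unfolding eq
    by (auto simp: fPrecord_def) (metis not_le add.commute)+
qed

lemma sat_fMarker [simp]:
  "p \<notin> {10, 11, 12, 13} \<Longrightarrow> sat a e (fMarker p) \<longleftrightarrow> marker (e p)"
  by (simp add: fMarker_def marker_def)

lemma sat_fFirst [simp]:
  "p \<notin> {10, 11, 12, 13, 14} \<Longrightarrow> sat a e (fFirst p) \<longleftrightarrow> first_marker (e p)"
  by (simp add: fFirst_def first_marker_def not_less)

lemma sat_fNext [simp]:
  "p \<notin> {10, 11, 12, 13, 14} \<Longrightarrow> r \<notin> {10, 11, 12, 13, 14} \<Longrightarrow>
     sat a e (fNext p r) \<longleftrightarrow> next_marker (e p) (e r)"
  by (simp add: fNext_def next_marker_def not_less) (meson leD leI)

lemma sat_fCode [simp]: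
  "c < 10 \<Longrightarrow> sat a e (fCode c) \<longleftrightarrow> code (e c)"
  by (simp add: fCode_def code_def not_less) (meson leD leI)

lemma sat_fDigit [simp]:
  "p < 10 \<Longrightarrow> c < 10 \<Longrightarrow> sat a e (fDigit p c) \<longleftrightarrow> digit (e p) (e c)"
  by (simp add: fDigit_def digit_def not_less)

section \<open>Definability and the isomorphism\<close>

lemma definable_unary:
  assumes "free_vars p \<subseteq> {0}" "\<And>e. sat a e p \<longleftrightarrow> Q (e 0)"
  shows "definable a 1 {[x] | x. Q x}"
  unfolding definable_def
proof (intro exI conjI)
  show "free_vars p \<subseteq> {..<1}" using assms(1) by auto
  show "{[x] |x. Q x} = {xs \<in> real_space 1. sat a ((!) xs) p}"
    by (auto simp: real_space_def assms(2) length_Suc_conv)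
qed

lemma definable_binary:
  assumes "free_vars p \<subseteq> {0, 1}" "\<And>e. sat a e p \<longleftrightarrow> Q (e 0) (e 1)"
  shows "definable a (1 + 1) {[x, y] | x y. Q x y}"
  unfolding definable_def
proof (intro exI conjI)
  show "free_vars p \<subseteq> {..<1 + 1}" using assms(1) by auto
  show "{[x, y] |x y. Q x y} = {xs \<in> real_space (1 + 1). sat a ((!) xs) p}"
    by (auto simp: real_space_def assms(2) length_Suc_conv)
qed

lemma definable_marker: "definable a 1 {[x] | x. marker x}"
  by (rule definable_unary[of "fMarker 0"]) simp_all

lemma definable_code: "definable a 1 {[c] | c. code c}"
  by (rule definable_unary[of "fCode 0"]) simp_all

lemma definable_next: "definable a (1 + 1) {[x, y] | x y. next_marker x y}"
  by (rule definable_binary[of "fNext 0 1"]) simp_all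

lemma definable_digit: "definable a (1 + 1) {[x, c] | x c. marker x \<and> code c \<and> digit x c}"
  by (rule definable_binary[of "And (fMarker 0) (And (fCode 1) (fDigit 0 1))"]) simp_all

text \<open>Off the markers the value is arbitrary; definability concerns only the graph over
  markers, which is \<open>next_marker\<close>.\<close>

definition succ_mark :: "real list \<Rightarrow> real list" where
  "succ_mark xs = [mark (Suc (inv mark (hd xs)))]"

definition digits :: "real list \<Rightarrow> nat set" where
  "digits xs = {i. digit (mark i) (hd xs)}"

lemma inv_mark [simp]: "inv mark (mark i) = i"
  by (rule inv_f_f) (simp add: inj_def)

lemma bij_betw_inv_mark: "bij_betw (\<lambda>xs. inv mark (hd xs)) {[x] | x. marker x} UNIV"
  by (rule bij_betw_byWitness[where f' = "\<lambda>i. [mark i]"]) (auto simp: marker_iff)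

text \<open>A code \<open>c\<close> and \<open>total (digits [c])\<close> have the same digits, so
  \<open>code_inject\<close> makes them equal: the codes are exactly the subset sums.\<close>

lemma bij_betw_digits: "bij_betw digits {[c] | c. code c} UNIV"
  by (rule bij_betw_byWitness[where f' = "\<lambda>X. [total X]"])
    (auto simp: digits_def digit_total code_total intro: code_inject)

lemma interpretation_exists:
  "\<exists>(n :: nat) W J s E.
    W \<subseteq> real_space n \<and> J \<subseteq> real_space n \<and> s ` W \<subseteq> W \<and> E \<subseteq> W \<times> J \<and>
    definable a n W \<and> definable a n J \<and> definable_fun a n W s \<and> definable_rel a n E \<and>
    two_sorted_iso W J s E
      (UNIV :: nat set) (UNIV :: nat set set) Suc {(k, X). k \<in> X}"
proof -
  let ?W = "{[x] | x. marker x}" and ?J = "{[c] | c. code c}"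
  let ?E = "{([x], [c]) | x c. marker x \<and> code c \<and> digit x c}"
  have "{x @ succ_mark x |x. x \<in> ?W} = {[x, y] | x y. next_marker x y}"
    by (auto simp: succ_mark_def marker_iff next_marker_iff)
  then have "definable_fun a 1 ?W succ_mark"
    unfolding definable_fun_def using definable_next by simp
  moreover have "{x @ c |x c. (x, c) \<in> ?E} = {[x, c] | x c. marker x \<and> code c \<and> digit x c}"
  proof (intro equalityI subsetI)
    fix z assume "z \<in> {[x, c] | x c. marker x \<and> code c \<and> digit x c}"
    then obtain x c where "z = [x] @ [c]" "([x], [c]) \<in> ?E" by auto
    then show "z \<in> {x @ c |x c. (x, c) \<in> ?E}" by blast
  qed auto
  then have "definable_rel a 1 ?E"
    unfolding definable_rel_def using definable_digit by simp
  moreover have "two_sorted_iso ?W ?J succ_mark ?E UNIV UNIV Suc {(k, X). k \<in> X}"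
    unfolding two_sorted_iso_def
    using bij_betw_inv_mark bij_betw_digits
    by (intro exI[of _ "\<lambda>xs. inv mark (hd xs)"] exI[of _ digits])
      (auto simp: succ_mark_def digits_def marker_iff)
  moreover have "?W \<subseteq> real_space 1" "?J \<subseteq> real_space 1" "succ_mark ` ?W \<subseteq> ?W" "?E \<subseteq> ?W \<times> ?J"
    by (auto simp: real_space_def succ_mark_def marker_iff)
  ultimately show ?thesis
    using definable_marker definable_code by blast
qed

end

theorem theoremD:
  fixes a :: real
  assumes "a \<notin> \<rat>"
  shows "\<exists>(n :: nat) W J s E.
    W \<subseteq> real_space n \<and> J \<subseteq> real_space n \<and> s ` W \<subseteq> W \<and> E \<subseteq> W \<times> J \<and>
    definable a n W \<and> definable a n J \<and> definable_fun a n W s \<and> definable_rel a n E \<and>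
    two_sorted_iso W J s E
      (UNIV :: nat set) (UNIV :: nat set set) Suc {(k, X). k \<in> X}"
  by (rule irrational.interpretation_exists) (rule irrational.intro[OF assms])

end
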